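(* For every generalized estimator $\tau$ and every $\theta\in\Theta$, $$\Lambda(\tau)(\theta)=\Bigl[\mathrm{Corr}_\theta\bigl(\tau(\cdot,\theta),\gamma^{(1)}_\theta\bigr)\Bigr]^2 I(\theta)\;\le\; I(\theta),$$ with equality at $\theta$ if and only if $\tau(\cdot,\theta)$ is almost surely a scalar multiple of the score $\gamma^{(1)}_\theta$. The score $\gamma^{(1)}:(s,\theta)\mapsto\gamma^{(1)}_\theta(s)$ is a generalized estimator with $\Lambda(\gamma^{(1)})=I$; it attains the bound at every $\theta\in\Theta$.
   Context: Setting. $S$ is a sample space with $\sigma$-field $\mathcal{A}$, $\Theta\subseteq\mathbb{R}$ is an open interval, and $\{P_\theta:\theta\in\Theta\}$ is a family of mutually absolutely continuous probability measures on $\mathcal{A}$ with $dP_\theta=\ell_\theta\,d\mu$ for a common measure $\mu$. $E_\theta$, $\mathrm{Var}_\theta$, $\mathrm{Corr}_\theta$ denote expectation, variance and correlation under $P_\theta$, and $V_\theta=L^2(S,\mathcal{A},P_\theta)$. The likelihood ratios $dP_\delta/dP_\theta$ are assumed to lie in $V_\theta$ for all $\delta,\theta\in\Theta$. A prime denotes differentiation with respect to the parameter. Score and Fisher information. The score at $\theta$ is $\gamma^{(1)}_\theta(s)=\ell_\theta'(s)/\ell_\theta(s)$, and the Fisher information is $I(\theta)=E_\theta\bigl[(\gamma^{(1)}_\theta)^2\bigr]=\mathrm{Var}_\theta(\gamma^{(1)}_\theta)$. Regularity conditions on the family. (1) $\ell_\theta(s)>0$ and $\delta\mapsto\ell_\delta(s)$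 is continuously differentiable for each $s$. (2) For each $\theta$ there is $\varepsilon=\varepsilon(\theta)>0$ such that $m_\theta(s)=\sup_{|\delta-\theta|\le\varepsilon}|\gamma^{(1)}_\delta(s)|$ satisfies $E_\theta(m_\theta^2)<\infty$. (3) $I(\theta)>0$ for every $\theta\in\Theta$. Generalized estimator. A generalized estimator is a function $\tau:S\times\Theta\to\mathbb{R}$ such that (i) $\tau(\cdot,\theta)\in V_\theta$ and $E_\theta(\tau(\cdot,\theta))=0$ for every $\theta\in\Theta$; (ii) $\tau(s,\cdot)$ is continuously differentiable on $\Theta$ for almost every $s$; (iii) $\mathrm{Var}(\tau)(\theta):=E_\theta\bigl(\tau(\cdot,\theta)^2\bigr)>0$ for every $\theta\in\Theta$. Information. Let $\bar\tau=\tau/\sqrt{\mathrm{Var}(\tau)}$ be the standardization of $\tau$. The information utilized by $\tau$ is the function on $\Theta$ $$\Lambda(\tau)(\theta)=\bigl(E_\theta(\bar\tau'(\cdot,\theta))\bigr)^2=\frac{\bigl(E_\theta(\tau'(\cdot,\theta))\bigr)^2}{\mathrm{Var}(\tau)(\theta)}.$$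
   Formalization: Added, since the claim fails without them: at θ, the difference quotients of δ ↦ τ(s,δ)ℓ_δ(s) are locally dominated by a μ-integrable function (also for the score in Λ(γ)=I); and, for the score claims, ℓ'_θ(s) is continuously differentiable in θ for almost every s. *)

theory Defs
  imports "HOL-Probability.Probability"
begin

text \<open>
  Argument conventions: a family of densities \<open>l\<close> is applied as \<open>l \<theta> s\<close>, a generalized
  estimator \<open>\<tau>\<close> as \<open>\<tau> s \<theta>\<close>. Densities are taken with respect to the measure \<open>M\<close>.
\<close>

text \<open>
  The expectation is taken with respect to the completion of the measure. This changes nothing for
  measurable functions. It matters for \<open>\<tau>'(\<cdot>, \<theta>)\<close>: this derivative exists only for almost every \<open>s\<close>,
  so the total function \<open>\<lambda>s. deriv (\<tau> s) \<theta>\<close> is in general only almost everywhere equal to a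
  measurable one.
\<close>

definition expect :: "'s measure \<Rightarrow> ('s \<Rightarrow> real) \<Rightarrow> real" where
  "expect P f = (\<integral>s. f s \<partial>completion P)"

definition var :: "'s measure \<Rightarrow> ('s \<Rightarrow> real) \<Rightarrow> real" where
  "var P f = expect P (\<lambda>s. (f s - expect P f)\<^sup>2)"

definition corr :: "'s measure \<Rightarrow> ('s \<Rightarrow> real) \<Rightarrow> ('s \<Rightarrow> real) \<Rightarrow> real" where
  "corr P f g =
     expect P (\<lambda>s. (f s - expect P f) * (g s - expect P g)) / (sqrt (var P f) * sqrt (var P g))"

definition L2_space :: "'s measure \<Rightarrow> ('s \<Rightarrow> real) set" where
  "L2_space P = {f \<in> borel_measurable P. integrable P (\<lambda>s. (f s)\<^sup>2)}"

definition score :: "(real \<Rightarrow> 's \<Rightarrow> real) \<Rightarrow> real \<Rightarrow> 's \<Rightarrow> real" where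
  "score l \<theta> s = deriv (\<lambda>\<delta>. l \<delta> s) \<theta> / l \<theta> s"

definition fisher_information ::
  "(real \<Rightarrow> 's measure) \<Rightarrow> (real \<Rightarrow> 's \<Rightarrow> real) \<Rightarrow> real \<Rightarrow> real" where
  "fisher_information P l \<theta> = expect (P \<theta>) (\<lambda>s. (score l \<theta> s)\<^sup>2)"

locale regular_family =
  fixes \<Theta> :: "real set"
    and M :: "'s measure"
    and P :: "real \<Rightarrow> 's measure"
    and l :: "real \<Rightarrow> 's \<Rightarrow> real"
  assumes open_param: "open \<Theta>"
    and interval_param: "is_interval \<Theta>"
    and density_measurable: "\<And>\<theta>. \<theta> \<in> \<Theta> \<Longrightarrow> l \<theta> \<in> borel_measurable M"
    and P_eq_density: "\<And>\<theta>. \<theta> \<in> \<Theta> \<Longrightarrow> P \<theta> = density M (\<lambda>s. ennreal (l \<theta> s))"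
    and prob: "\<And>\<theta>. \<theta> \<in> \<Theta> \<Longrightarrow> prob_space (P \<theta>)"
    and mutually_abs_cont: "\<And>\<theta> \<delta>. \<theta> \<in> \<Theta> \<Longrightarrow> \<delta> \<in> \<Theta> \<Longrightarrow> absolutely_continuous (P \<theta>) (P \<delta>)"
    and likelihood_ratio_L2:
      "\<And>\<theta> \<delta>. \<theta> \<in> \<Theta> \<Longrightarrow> \<delta> \<in> \<Theta> \<Longrightarrow> (\<lambda>s. enn2real (RN_deriv (P \<theta>) (P \<delta>) s)) \<in> L2_space (P \<theta>)"
    and density_pos: "\<And>\<theta> s. \<theta> \<in> \<Theta> \<Longrightarrow> s \<in> space M \<Longrightarrow> l \<theta> s > 0"
    and density_C1: "\<And>s. s \<in> space M \<Longrightarrow> (\<lambda>\<delta>. l \<delta> s) C1_differentiable_on \<Theta>"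
    and local_score_bound_L2:
      "\<And>\<theta>. \<theta> \<in> \<Theta> \<Longrightarrow> \<exists>\<epsilon>>0. cball \<theta> \<epsilon> \<subseteq> \<Theta> \<and>
         (\<lambda>s. SUP \<delta>\<in>cball \<theta> \<epsilon>. \<bar>score l \<delta> s\<bar>) \<in> L2_space (P \<theta>)"
    and fisher_information_pos: "\<And>\<theta>. \<theta> \<in> \<Theta> \<Longrightarrow> fisher_information P l \<theta> > 0"

definition estimator_var :: "(real \<Rightarrow> 's measure) \<Rightarrow> ('s \<Rightarrow> real \<Rightarrow> real) \<Rightarrow> real \<Rightarrow> real" where
  "estimator_var P \<tau> \<theta> = expect (P \<theta>) (\<lambda>s. (\<tau> s \<theta>)\<^sup>2)"

definition generalized_estimator ::
  "real set \<Rightarrow> (real \<Rightarrow> 's measure) \<Rightarrow> ('s \<Rightarrow> real \<Rightarrow> real) \<Rightarrow> bool" where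
  "generalized_estimator \<Theta> P \<tau> \<longleftrightarrow>
     (\<forall>\<theta>\<in>\<Theta>. (\<lambda>s. \<tau> s \<theta>) \<in> L2_space (P \<theta>) \<and> expect (P \<theta>) (\<lambda>s. \<tau> s \<theta>) = 0) \<and>
     (\<forall>\<theta>\<in>\<Theta>. AE s in P \<theta>. \<tau> s C1_differentiable_on \<Theta>) \<and>
     (\<forall>\<theta>\<in>\<Theta>. estimator_var P \<tau> \<theta> > 0)"

definition information :: "(real \<Rightarrow> 's measure) \<Rightarrow> ('s \<Rightarrow> real \<Rightarrow> real) \<Rightarrow> real \<Rightarrow> real" where
  "information P \<tau> \<theta> = (expect (P \<theta>) (\<lambda>s. deriv (\<tau> s) \<theta>))\<^sup>2 / estimator_var P \<tau> \<theta>"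

definition standardization ::
  "(real \<Rightarrow> 's measure) \<Rightarrow> ('s \<Rightarrow> real \<Rightarrow> real) \<Rightarrow> 's \<Rightarrow> real \<Rightarrow> real" where
  "standardization P \<tau> s \<theta> = \<tau> s \<theta> / sqrt (estimator_var P \<tau> \<theta>)"

text \<open>
  Local domination of the difference quotients at \<open>\<theta>\<close>: the classical sufficient condition for
  differentiating \<open>\<delta> \<mapsto> \<integral> \<tau>(s,\<delta>) l\<^sub>\<delta>(s) d\<mu>\<close> under the integral sign at \<open>\<theta>\<close>.
  It follows from an integrable bound on \<open>\<bar>(\<tau> l)'\<bar>\<close> near \<open>\<theta>\<close>, but is weaker.
  It is not implied by \<open>regular_family\<close> and \<open>generalized_estimator\<close>, which put no
  bound on \<open>\<tau>'\<close>.
\<close>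

definition dominated_at ::
  "real set \<Rightarrow> 's measure \<Rightarrow> (real \<Rightarrow> 's \<Rightarrow> real) \<Rightarrow> ('s \<Rightarrow> real \<Rightarrow> real) \<Rightarrow> real \<Rightarrow> bool" where
  "dominated_at \<Theta> M l \<tau> \<theta> \<longleftrightarrow>
     (\<exists>\<epsilon>>0. \<exists>G. integrable M G \<and>
        (AE s in M. \<forall>\<delta>\<in>\<Theta> \<inter> cball \<theta> \<epsilon>. \<bar>\<tau> s \<delta> * l \<delta> s - \<tau> s \<theta> * l \<theta> s\<bar> \<le> G s * \<bar>\<delta> - \<theta>\<bar>))"

lemma borel_measurable_completion_cong_AE:
  fixes f g :: "'s \<Rightarrow> real"
  assumes f: "f \<in> borel_measurable (completion N)" and AE: "AE s in completion N. f s = g s"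
  shows "g \<in> borel_measurable (completion N)"
proof (rule measurableI)
  fix A :: "real set" assume "A \<in> sets borel"
  then have A: "f -` A \<inter> space (completion N) \<in> sets (completion N)"
    using f by (rule measurable_sets[rotated])
  show "g -` A \<inter> space (completion N) \<in> sets (completion N)"
  proof (rule completion.in_sets_AE[OF _ A])
    show "AE s in completion N.
        (s \<in> f -` A \<inter> space (completion N)) = (s \<in> g -` A \<inter> space (completion N))"
      using AE by eventually_elim simp
  qed simp
qed simp

lemma integral_completion_cong_AE:
  fixes f g :: "'s \<Rightarrow> real"
  assumes AE: "AE s in completion N. f s = g s"
  shows "(\<integral>s. f s \<partial>completion N) = (\<integral>s. g s \<partial>completion N)"
proof (cases "f \<in> borel_measurable (completion N)")
  case True
  then have "g \<in> borel_measurable (completion N)"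
    using AE by (rule borel_measurable_completion_cong_AE)
  with True AE show ?thesis by (intro integral_cong_AE)
next
  case False
  have "AE s in completion N. g s = f s" using AE by eventually_elim simp
  with False have "g \<notin> borel_measurable (completion N)"
    using borel_measurable_completion_cong_AE by blast
  with False have "\<not> integrable (completion N) f" "\<not> integrable (completion N) g" by auto
  then show ?thesis by (simp add: not_integrable_integral_eq)
qed

text \<open>
  The information is the squared expected slope of the standardized estimator, wherever the
  latter is differentiable.
\<close>

lemma information_eq_standardization:
  assumes est: "generalized_estimator \<Theta> P \<tau>" and "open \<Theta>" "\<theta> \<in> \<Theta>" and prob: "prob_space (P \<theta>)"
    and diff: "(\<lambda>\<delta>. estimator_var P \<tau> \<delta>) differentiable at \<theta>"
  shows "information P \<tau> \<theta> = (expect (P \<theta>) (\<lambda>s. deriv (standardization P \<tau> s) \<theta>))\<^sup>2"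
proof -
  define V where "V = estimator_var P \<tau>"
  define D where "D = deriv (\<lambda>\<delta>. 1 / sqrt (V \<delta>)) \<theta>"
  have V: "V \<theta> > 0" using est \<open>\<theta> \<in> \<Theta>\<close> by (auto simp: generalized_estimator_def V_def)
  have "V field_differentiable at \<theta>"
    using diff by (simp add: V_def field_differentiable_def real_differentiable_def)
  then obtain V' where V': "(V has_real_derivative V') (at \<theta>)"
    by (auto simp: field_differentiable_def)
  have "((\<lambda>\<delta>. 1 / sqrt (V \<delta>)) has_real_derivative - (V' * (inverse (sqrt (V \<theta>)) / 2)) / (V \<theta>)) (at \<theta>)"
    using V by (auto intro!: derivative_eq_intros V' simp: field_simps)
  then have D: "((\<lambda>\<delta>. 1 / sqrt (V \<delta>)) has_real_derivative D) (at \<theta>)"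
    unfolding D_def by (metis DERIV_imp_deriv)
  have L2: "(\<lambda>s. \<tau> s \<theta>) \<in> L2_space (P \<theta>)" and mean: "expect (P \<theta>) (\<lambda>s. \<tau> s \<theta>) = 0"
    using est \<open>\<theta> \<in> \<Theta>\<close> by (auto simp: generalized_estimator_def)
  interpret prob_space "P \<theta>" by (rule prob)
  have meas: "(\<lambda>s. \<tau> s \<theta>) \<in> borel_measurable (P \<theta>)"
    using L2 by (simp add: L2_space_def)
  have "integrable (P \<theta>) (\<lambda>s. \<tau> s \<theta>)"
    using square_integrable_imp_integrable[OF meas] L2 by (simp add: L2_space_def)
  then have int: "integrable (completion (P \<theta>)) (\<lambda>s. \<tau> s \<theta> * D)"
    using meas by (intro integrable_mult_left) (simp add: integrable_completion)
  have zero: "(\<integral>s. \<tau> s \<theta> * D \<partial>completion (P \<theta>)) = 0"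
    using mean by (simp add: expect_def)
  define R where "R = (\<lambda>s. deriv (standardization P \<tau> s) \<theta> - \<tau> s \<theta> * D)"
  have AE: "AE s in completion (P \<theta>). R s = deriv (\<tau> s) \<theta> / sqrt (V \<theta>)"
  proof (rule AE_completion)
    have "AE s in P \<theta>. \<tau> s C1_differentiable_on \<Theta>"
      using est \<open>\<theta> \<in> \<Theta>\<close> by (auto simp: generalized_estimator_def)
    then show "AE s in P \<theta>. R s = deriv (\<tau> s) \<theta> / sqrt (V \<theta>)"
    proof eventually_elim
      case (elim s)
      then obtain d where d: "(\<tau> s has_real_derivative d) (at \<theta>)"
        using \<open>\<theta> \<in> \<Theta>\<close>
        by (auto simp: C1_differentiable_on_def has_real_derivative_iff_has_vector_derivative)
      have "((\<lambda>\<delta>. \<tau> s \<delta> * (1 / sqrt (V \<delta>))) has_real_derivative \<tau> s \<theta> * D + d * (1 / sqrt (V \<theta>))) (at \<theta>)"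
        using DERIV_mult'[OF d D] by simp
      then have "(standardization P \<tau> s has_real_derivative \<tau> s \<theta> * D + d / sqrt (V \<theta>)) (at \<theta>)"
        by (simp add: standardization_def[abs_def] V_def)
      then show ?case
        using DERIV_imp_deriv[OF d] by (simp add: R_def DERIV_imp_deriv)
    qed
  qed
  have "expect (P \<theta>) (\<lambda>s. deriv (standardization P \<tau> s) \<theta>) = (\<integral>s. R s \<partial>completion (P \<theta>))"
  proof (cases "integrable (completion (P \<theta>)) (\<lambda>s. deriv (standardization P \<tau> s) \<theta>)")
    case True
    then show ?thesis using int zero by (simp add: R_def expect_def)
  next
    case False
    have "\<not> integrable (completion (P \<theta>)) R"
    proof
      assume "integrable (completion (P \<theta>)) R"
      from Bochner_Integration.integrable_add[OF this int] False show False
        by (simp add: R_def)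
    qed
    with False show ?thesis by (simp add: expect_def not_integrable_integral_eq)
  qed
  also have "\<dots> = (\<integral>s. deriv (\<tau> s) \<theta> / sqrt (V \<theta>) \<partial>completion (P \<theta>))"
    using AE by (rule integral_completion_cong_AE)
  also have "\<dots> = expect (P \<theta>) (\<lambda>s. deriv (\<tau> s) \<theta>) / sqrt (V \<theta>)"
    by (simp add: expect_def)
  finally show ?thesis
    using V by (simp add: information_def power_divide V_def)
qed

end

theory Submission
  imports Defs
begin

text \<open>
  The heart of the matter is the identity \<open>E \<tau>' = - E (\<tau> \<gamma>)\<close>, obtained by differentiating
  \<open>\<integral> \<tau> l d\<mu> = 0\<close>, followed by Cauchy--Schwarz. The correlation is centred, so one also needs
  \<open>E \<gamma> = 0\<close>; since only \<open>\<gamma>\<close>, and not \<open>l'\<close>, is locally dominated, dominated convergence does not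
  apply directly. Instead, \<open>x - 1 \<ge> ln x\<close> and the mean value theorem for \<open>ln l\<close> bound the
  one-sided difference quotients of \<open>l / l\<^sub>\<theta>\<close> from one side by the local bound on the score, and
  Fatou's lemma, applied on both sides of \<open>\<theta>\<close>, gives the two inequalities.
\<close>

text \<open>Fatou's lemma applied to the nonnegative functions \<open>u n - g\<close>. An integrable
  minorant \<open>g\<close> alone controls the limit of the integrals from one side, so the
  conclusion is an inequality. Since \<open>f\<close> is assumed integrable, the extended
  nonnegative integral can be read back as a real one.\<close>

lemma integral_le_of_AE_lim_bounded_below:
  fixes u :: "nat \<Rightarrow> 'a \<Rightarrow> real"
  assumes u: "\<And>n. integrable M (u n)" and f: "integrable M f" and g: "integrable M g"
    and lower: "\<And>n. AE x in M. g x \<le> u n x"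
    and lim: "AE x in M. (\<lambda>n. u n x) \<longlonglongrightarrow> f x"
    and bound: "\<And>n. (\<integral>x. u n x \<partial>M) \<le> C"
  shows "(\<integral>x. f x \<partial>M) \<le> C"
proof -
  have low: "AE x in M. \<forall>n. g x \<le> u n x" using lower by (simp add: AE_all_countable)
  have fg: "AE x in M. 0 \<le> f x - g x"
    using low lim by eventually_elim (auto intro: LIMSEQ_le_const)
  have int_ug: "(\<integral>x. u n x - g x \<partial>M) \<le> C - (\<integral>x. g x \<partial>M)" for n
    using bound[of n] by (simp add: u g)
  have "ennreal (\<integral>x. f x - g x \<partial>M) = (\<integral>\<^sup>+x. ennreal (f x - g x) \<partial>M)"
    using f g fg by (intro nn_integral_eq_integral[symmetric]) auto
  also have "\<dots> = (\<integral>\<^sup>+x. liminf (\<lambda>n. ennreal (u n x - g x)) \<partial>M)"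
  proof (rule nn_integral_cong_AE)
    show "AE x in M. ennreal (f x - g x) = liminf (\<lambda>n. ennreal (u n x - g x))"
      using lim
    proof eventually_elim
      case (elim x)
      then have "(\<lambda>n. ennreal (u n x - g x)) \<longlonglongrightarrow> ennreal (f x - g x)"
        by (intro tendsto_ennrealI tendsto_intros)
      then show ?case by (simp add: lim_imp_Liminf)
    qed
  qed
  also have "\<dots> \<le> liminf (\<lambda>n. \<integral>\<^sup>+x. ennreal (u n x - g x) \<partial>M)"
    using u g by (intro nn_integral_liminf) auto
  also have "\<dots> = liminf (\<lambda>n. ennreal (\<integral>x. u n x - g x \<partial>M))"
    using u g lower by (subst nn_integral_eq_integral) auto
  also have "\<dots> \<le> liminf (\<lambda>n. ennreal (C - (\<integral>x. g x \<partial>M)))"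
    using int_ug by (intro Liminf_mono always_eventually allI ennreal_leI)
  also have "\<dots> = ennreal (C - (\<integral>x. g x \<partial>M))" by (simp add: Liminf_const)
  finally have *: "ennreal (\<integral>x. f x - g x \<partial>M) \<le> ennreal (C - (\<integral>x. g x \<partial>M))" .
  \<comment> \<open>\<open>ennreal\<close> sends negative reals to \<open>0\<close>, so
    \<open>*\<close> yields a real inequality only once its right-hand side is known to be
    nonnegative; any single member of the sequence shows this.\<close>
  have "0 \<le> (\<integral>x. u 0 x - g x \<partial>M)" using lower by (intro integral_nonneg_AE) auto
  then have "0 \<le> C - (\<integral>x. g x \<partial>M)" using int_ug order_trans by blast
  with * have "(\<integral>x. f x - g x \<partial>M) \<le> C - (\<integral>x. g x \<partial>M)" by (simp add: ennreal_le_iff)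
  then show ?thesis using f g by simp
qed

section \<open>Square-integrable functions and Cauchy-Schwarz\<close>

lemma expect_eq_integral:
  assumes "f \<in> borel_measurable N"
  shows "expect N f = (\<integral>x. f x \<partial>N)"
  unfolding expect_def by (rule integral_completion[OF assms])

lemma L2_space_integrable_mult:
  assumes "f \<in> L2_space N" "g \<in> L2_space N"
  shows "integrable N (\<lambda>x. f x * g x)"
proof (rule Bochner_Integration.integrable_bound)
  show "integrable N (\<lambda>x. (f x)\<^sup>2 + (g x)\<^sup>2)" using assms by (auto simp: L2_space_def)
  show "(\<lambda>x. f x * g x) \<in> borel_measurable N" using assms by (auto simp: L2_space_def)
  have "\<bar>a * b\<bar> \<le> a\<^sup>2 + b\<^sup>2" for a b :: real
  proof -
    have "2 * \<bar>a * b\<bar> \<le> a\<^sup>2 + b\<^sup>2"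
      using sum_squares_bound[of "\<bar>a\<bar>" "\<bar>b\<bar>"] by (simp add: abs_mult)
    then show ?thesis using abs_ge_zero[of "a * b"] by linarith
  qed
  then show "AE x in N. norm (f x * g x) \<le> norm ((f x)\<^sup>2 + (g x)\<^sup>2)"
    by (intro AE_I2) (simp add: abs_of_nonneg)
qed

lemma L2_residual_integral:
  fixes c :: real
  assumes f: "f \<in> L2_space N" and g: "g \<in> L2_space N"
  shows "integrable N (\<lambda>x. (f x - c * g x)\<^sup>2)"
    and "(\<integral>x. (f x - c * g x)\<^sup>2 \<partial>N) =
      (\<integral>x. (f x)\<^sup>2 \<partial>N) - 2 * c * (\<integral>x. f x * g x \<partial>N) + c\<^sup>2 * (\<integral>x. (g x)\<^sup>2 \<partial>N)"
proof -
  have ff: "integrable N (\<lambda>x. (f x)\<^sup>2)" and gg: "integrable N (\<lambda>x. (g x)\<^sup>2)"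
    using f g by (auto simp: L2_space_def)
  note fg = L2_space_integrable_mult[OF f g]
  have eq: "(\<lambda>x. (f x - c * g x)\<^sup>2) = (\<lambda>x. (f x)\<^sup>2 - 2 * c * (f x * g x) + c\<^sup>2 * (g x)\<^sup>2)"
    by (rule ext) (simp add: power2_eq_square algebra_simps)
  show "integrable N (\<lambda>x. (f x - c * g x)\<^sup>2)"
    unfolding eq using ff gg fg by (intro Bochner_Integration.integrable_add Bochner_Integration.integrable_diff integrable_mult_right) auto
  show "(\<integral>x. (f x - c * g x)\<^sup>2 \<partial>N) =
      (\<integral>x. (f x)\<^sup>2 \<partial>N) - 2 * c * (\<integral>x. f x * g x \<partial>N) + c\<^sup>2 * (\<integral>x. (g x)\<^sup>2 \<partial>N)"
    unfolding eq using ff gg fg by simp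
qed

text \<open>Both claims come from the residual of the orthogonal projection of \<open>f\<close> onto
  \<open>g\<close>: its squared norm is nonnegative, and it vanishes exactly when \<open>f\<close>
  is almost everywhere a multiple of \<open>g\<close>. Division by the norm of \<open>f\<close>
  gives the inequality the shape of \<open>information\<close>.\<close>

lemma L2_Cauchy_Schwarz:
  assumes f: "f \<in> L2_space N" and g: "g \<in> L2_space N"
    and pos: "(\<integral>x. (f x)\<^sup>2 \<partial>N) > 0" "(\<integral>x. (g x)\<^sup>2 \<partial>N) > 0"
  shows "(\<integral>x. f x * g x \<partial>N)\<^sup>2 / (\<integral>x. (f x)\<^sup>2 \<partial>N) \<le> (\<integral>x. (g x)\<^sup>2 \<partial>N)"
    and "(\<integral>x. f x * g x \<partial>N)\<^sup>2 / (\<integral>x. (f x)\<^sup>2 \<partial>N) = (\<integral>x. (g x)\<^sup>2 \<partial>N) \<longleftrightarrow>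
      (\<exists>c. AE x in N. f x = c * g x)"
proof -
  define a b c where "a = (\<integral>x. (f x)\<^sup>2 \<partial>N)" and "b = (\<integral>x. (g x)\<^sup>2 \<partial>N)"
    and "c = (\<integral>x. f x * g x \<partial>N)"
  have ab: "a > 0" "b > 0" using pos by (auto simp: a_def b_def)
  \<comment> \<open>The factor \<open>c / b\<close> is the projection coefficient, which minimizes
    the quadratic polynomial of \<open>L2_residual_integral\<close>.\<close>
  have res: "(\<integral>x. (f x - c / b * g x)\<^sup>2 \<partial>N) = a - c\<^sup>2 / b"
    unfolding L2_residual_integral(2)[OF f g] a_def[symmetric] b_def[symmetric] c_def[symmetric]
    using ab by (simp add: power2_eq_square field_simps)
  have "0 \<le> (\<integral>x. (f x - c / b * g x)\<^sup>2 \<partial>N)" by simp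
  then have "0 \<le> a - c\<^sup>2 / b" unfolding res .
  then have "c\<^sup>2 / a \<le> b" using ab by (simp add: field_simps)
  then show "(\<integral>x. f x * g x \<partial>N)\<^sup>2 / (\<integral>x. (f x)\<^sup>2 \<partial>N) \<le> (\<integral>x. (g x)\<^sup>2 \<partial>N)"
    by (simp add: a_def b_def c_def)
  have "c\<^sup>2 / a = b \<longleftrightarrow> (\<exists>k. AE x in N. f x = k * g x)"
  proof
    assume "c\<^sup>2 / a = b"
    then have "(\<integral>x. (f x - c / b * g x)\<^sup>2 \<partial>N) = 0"
      unfolding res using ab by (simp add: field_simps)
    then have "AE x in N. (f x - c / b * g x)\<^sup>2 = 0"
      by (subst (asm) integral_nonneg_eq_0_iff_AE[OF L2_residual_integral(1)[OF f g]]) auto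
    then have "AE x in N. f x = c / b * g x" by eventually_elim auto
    then show "\<exists>k. AE x in N. f x = k * g x" by blast
  next
    assume "\<exists>k. AE x in N. f x = k * g x"
    then obtain k where k: "AE x in N. f x = k * g x" by blast
    have m: "f \<in> borel_measurable N" "g \<in> borel_measurable N"
      using f g by (auto simp: L2_space_def)
    have "c = (\<integral>x. k * (g x)\<^sup>2 \<partial>N)" unfolding c_def
      using k m by (intro integral_cong_AE) (auto simp: power2_eq_square)
    moreover have "a = (\<integral>x. k\<^sup>2 * (g x)\<^sup>2 \<partial>N)" unfolding a_def
      using k m by (intro integral_cong_AE) (auto simp: power_mult_distrib)
    ultimately have "c = k * b" "a = k\<^sup>2 * b" by (auto simp: b_def)
    \<comment> \<open>Positivity of \<open>a\<close> forces \<open>k\<close> to be nonzero, which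
      permits the cancellation.\<close>
    then show "c\<^sup>2 / a = b" using ab by (auto simp: power2_eq_square)
  qed
  then show "(\<integral>x. f x * g x \<partial>N)\<^sup>2 / (\<integral>x. (f x)\<^sup>2 \<partial>N) = (\<integral>x. (g x)\<^sup>2 \<partial>N) \<longleftrightarrow>
      (\<exists>c. AE x in N. f x = c * g x)"
    by (simp add: a_def b_def c_def)
qed

section \<open>Quotient rule and one-sided difference quotients\<close>

lemma C1_differentiable_on_divide_real:
  fixes f g :: "real \<Rightarrow> real"
  assumes f: "f C1_differentiable_on S" and g: "g C1_differentiable_on S"
    and nz: "\<And>x. x \<in> S \<Longrightarrow> g x \<noteq> 0"
  shows "(\<lambda>x. f x / g x) C1_differentiable_on S"
proof -
  obtain f' g' where
    f': "\<And>x. x \<in> S \<Longrightarrow> (f has_real_derivative f' x) (at x)" "continuous_on S f'" and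
    g': "\<And>x. x \<in> S \<Longrightarrow> (g has_real_derivative g' x) (at x)" "continuous_on S g'"
    using f g by (auto simp: C1_differentiable_on_def has_real_derivative_iff_has_vector_derivative)
  have cont: "continuous_on S f" "continuous_on S g"
    using f'(1) g'(1) by (auto intro!: continuous_at_imp_continuous_on DERIV_isCont)
  show ?thesis
    unfolding C1_differentiable_on_def has_real_derivative_iff_has_vector_derivative[symmetric]
  proof (intro exI conjI ballI)
    show "((\<lambda>x. f x / g x) has_real_derivative (f' x * g x - f x * g' x) / (g x * g x)) (at x)"
      if "x \<in> S" for x
      using that f' g' nz by (auto intro!: DERIV_divide)
    show "continuous_on S (\<lambda>x. (f' x * g x - f x * g' x) / (g x * g x))"
      using cont f' g' nz by (auto intro!: continuous_intros)
  qed
qed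

text \<open>The sign \<open>\<sigma>\<close> selects the side from which \<open>x\<close> is
  approached. Dividing by the positive step \<open>h n\<close> instead of
  \<open>\<sigma> * h n\<close> moves the sign into the limit, so one argument covers both sides.
  Sequences are used because the convergence theorems for integrals are applied along them.\<close>

lemma DERIV_imp_quotient_LIMSEQ:
  fixes f :: "real \<Rightarrow> real"
  assumes "(f has_real_derivative d) (at x)" "h \<longlonglongrightarrow> 0" "\<And>n. h n > 0" "\<bar>\<sigma>\<bar> = (1::real)"
  shows "(\<lambda>n. (f (x + \<sigma> * h n) - f x) / h n) \<longlonglongrightarrow> \<sigma> * d"
proof -
  have "\<sigma> \<noteq> 0" using assms(4) by auto
  have "((\<lambda>k. (f (x + k) - f x) / k) \<longlongrightarrow> d) (at 0)" using assms(1) by (simp add: DERIV_def)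
  moreover have "(\<lambda>n. \<sigma> * h n) \<longlonglongrightarrow> 0" using assms(2) by (auto intro: tendsto_mult_right_zero)
  moreover have "\<sigma> * h n \<noteq> 0" for n using assms(3)[of n] \<open>\<sigma> \<noteq> 0\<close> by simp
  ultimately have "(\<lambda>n. (f (x + \<sigma> * h n) - f x) / (\<sigma> * h n)) \<longlonglongrightarrow> d"
    using tendsto_at_iff_sequentially[of "\<lambda>k. (f (x + k) - f x) / k" d 0 UNIV]
    by (auto simp: o_def)
  from tendsto_mult_left[OF this, of \<sigma>] show ?thesis using \<open>\<sigma> \<noteq> 0\<close> by simp
qed

section \<open>The score and change of measure in a regular family\<close>

context regular_family
begin

text \<open>Writing the derivative as score times density makes the score appear directly when
  \<open>ln l\<close> or a product \<open>\<tau> l\<close> is differentiated.\<close>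

lemma density_has_derivative:
  assumes "\<theta> \<in> \<Theta>" "s \<in> space M"
  shows "((\<lambda>\<delta>. l \<delta> s) has_real_derivative score l \<theta> s * l \<theta> s) (at \<theta>)"
proof -
  obtain d where d: "((\<lambda>\<delta>. l \<delta> s) has_real_derivative d) (at \<theta>)"
    using density_C1[OF assms(2)] assms(1)
    by (auto simp: C1_differentiable_on_def has_real_derivative_iff_has_vector_derivative)
  then show ?thesis
    using density_pos[OF assms] by (simp add: score_def DERIV_imp_deriv)
qed

lemma score_continuous_on:
  assumes s: "s \<in> space M"
  shows "continuous_on \<Theta> (\<lambda>\<theta>. score l \<theta> s)"
proof -
  obtain D where D: "\<And>x. x \<in> \<Theta> \<Longrightarrow> ((\<lambda>\<delta>. l \<delta> s) has_real_derivative D x) (at x)"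
      "continuous_on \<Theta> D"
    using density_C1[OF s]
    by (auto simp: C1_differentiable_on_def has_real_derivative_iff_has_vector_derivative)
  have "continuous_on \<Theta> (\<lambda>\<delta>. l \<delta> s)"
    using D(1) by (auto intro!: continuous_at_imp_continuous_on DERIV_isCont)
  moreover have "l x s \<noteq> 0" if "x \<in> \<Theta>" for x using density_pos[OF that s] by simp
  ultimately have "continuous_on \<Theta> (\<lambda>x. D x / l x s)" using D(2) by (intro continuous_on_divide) auto
  then show ?thesis
    by (rule continuous_on_eq) (simp add: score_def DERIV_imp_deriv[OF D(1)])
qed

text \<open>A real \<open>SUP\<close> is an upper bound only if the set is bounded above. Here the
  score is continuous in the parameter and the closed ball is compact.\<close>

lemma score_le_local_SUP:
  assumes "cball \<theta> \<epsilon> \<subseteq> \<Theta>" "s \<in> space M" "\<delta> \<in> cball \<theta> \<epsilon>"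
  shows "\<bar>score l \<delta> s\<bar> \<le> (SUP \<delta>\<in>cball \<theta> \<epsilon>. \<bar>score l \<delta> s\<bar>)"
proof (rule cSUP_upper[OF assms(3)])
  have "continuous_on (cball \<theta> \<epsilon>) (\<lambda>\<delta>. \<bar>score l \<delta> s\<bar>)"
    using continuous_on_subset[OF score_continuous_on[OF assms(2)] assms(1)]
    by (rule continuous_on_rabs)
  then have "compact ((\<lambda>\<delta>. \<bar>score l \<delta> s\<bar>) ` cball \<theta> \<epsilon>)"
    by (rule compact_continuous_image) simp
  then show "bdd_above ((\<lambda>\<delta>. \<bar>score l \<delta> s\<bar>) ` cball \<theta> \<epsilon>)"
    by (intro bounded_imp_bdd_above compact_imp_bounded)
qed

lemma sets_P [measurable_cong]: "\<theta> \<in> \<Theta> \<Longrightarrow> sets (P \<theta>) = sets M"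
  by (simp add: P_eq_density)

lemma space_P: "\<theta> \<in> \<Theta> \<Longrightarrow> space (P \<theta>) = space M"
  by (simp add: P_eq_density)

lemma borel_measurable_P: "\<theta> \<in> \<Theta> \<Longrightarrow> borel_measurable (P \<theta>) = borel_measurable M"
  by (rule measurable_cong_sets) (auto simp: sets_P)

text \<open>A density that is positive on the whole space leaves the null sets unchanged, so
  statements holding almost everywhere pass freely between \<open>M\<close> and every
  \<open>P \<theta>\<close>.\<close>

lemma AE_P_iff:
  assumes "\<theta> \<in> \<Theta>"
  shows "(AE s in P \<theta>. Q s) \<longleftrightarrow> (AE s in M. Q s)"
proof -
  have "(AE s in P \<theta>. Q s) \<longleftrightarrow> (AE s in M. 0 < ennreal (l \<theta> s) \<longrightarrow> Q s)"
    unfolding P_eq_density[OF assms] using density_measurable[OF assms]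
    by (intro AE_density) measurable
  also have "\<dots> \<longleftrightarrow> (AE s in M. Q s)"
    using density_pos[OF assms] by (intro AE_cong) auto
  finally show ?thesis .
qed

lemma integrable_P_iff:
  fixes f :: "'s \<Rightarrow> real"
  assumes "\<theta> \<in> \<Theta>" "f \<in> borel_measurable M"
  shows "integrable (P \<theta>) f \<longleftrightarrow> integrable M (\<lambda>s. l \<theta> s * f s)"
  unfolding P_eq_density[OF assms(1)]
  using density_pos[OF assms(1)] density_measurable[OF assms(1)] assms(2)
  by (subst integrable_density) (auto intro!: AE_I2 less_imp_le)

lemma integral_P:
  fixes f :: "'s \<Rightarrow> real"
  assumes "\<theta> \<in> \<Theta>" "f \<in> borel_measurable M"
  shows "(\<integral>s. f s \<partial>P \<theta>) = (\<integral>s. l \<theta> s * f s \<partial>M)"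
  unfolding P_eq_density[OF assms(1)]
  using density_pos[OF assms(1)] density_measurable[OF assms(1)] assms(2)
  by (subst integral_density) (auto intro!: AE_I2 less_imp_le)

text \<open>Openness of \<open>\<Theta>\<close> leaves room on both sides of
  \<open>\<theta>\<close>, so one sequence of step lengths serves both signs. The cap
  \<open>\<epsilon>\<close> keeps the steps where a local bound holds.\<close>

lemma obtain_interior_seq:
  assumes "\<theta> \<in> \<Theta>" "\<epsilon> > 0"
  obtains h :: "nat \<Rightarrow> real" where "\<And>n. h n > 0" "\<And>n. h n \<le> \<epsilon>" "h \<longlonglongrightarrow> 0"
    "\<And>n \<sigma>. \<bar>\<sigma>\<bar> = 1 \<Longrightarrow> \<theta> + \<sigma> * h n \<in> \<Theta>"
proof -
  obtain r where r: "r > 0" "cball \<theta> r \<subseteq> \<Theta>"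
    using open_param assms(1) open_contains_cball by blast
  define e where "e = min r \<epsilon>"
  have e: "e > 0" "e \<le> r" "e \<le> \<epsilon>" using r assms(2) by (auto simp: e_def)
  define h where "h = (\<lambda>n. e / real (Suc n))"
  have pos: "h n > 0" for n using e by (simp add: h_def)
  have le: "h n \<le> e" for n using e by (simp add: h_def divide_le_eq mult_left_le)
  have "\<theta> + \<sigma> * h n \<in> \<Theta>" if "\<bar>\<sigma>\<bar> = 1" for n \<sigma>
  proof -
    have "dist \<theta> (\<theta> + \<sigma> * h n) \<le> r"
      using that pos[of n] le[of n] e by (simp add: dist_real_def abs_mult)
    then show ?thesis using r by auto
  qed
  moreover have "h \<longlonglongrightarrow> 0" unfolding h_def by (rule lim_const_over_n[THEN LIMSEQ_Suc])
  ultimately show ?thesis using pos le e that by (metis order_trans)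
qed

text \<open>Measurability is assumed of the densities, not of their derivatives; the score inherits
  it as a pointwise limit of difference quotients along a fixed sequence.\<close>

lemma score_measurable:
  assumes \<theta>: "\<theta> \<in> \<Theta>"
  shows "score l \<theta> \<in> borel_measurable M"
proof -
  obtain h where h: "\<And>n. h n > 0" "h \<longlonglongrightarrow> 0" "\<And>n. \<theta> + 1 * h n \<in> \<Theta>"
    using obtain_interior_seq[OF \<theta>, of 1] by (metis abs_one zero_less_one)
  show ?thesis
  proof (rule borel_measurable_LIMSEQ_real)
    show "(\<lambda>n. (l (\<theta> + 1 * h n) s - l \<theta> s) / h n / l \<theta> s) \<longlonglongrightarrow> score l \<theta> s"
      if s: "s \<in> space M" for s
    proof -
      have "l \<theta> s \<noteq> 0" using density_pos[OF \<theta> s] by simp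
      then show ?thesis
        using tendsto_divide[OF DERIV_imp_quotient_LIMSEQ[OF density_has_derivative[OF \<theta> s] h(2,1), of 1]
            tendsto_const[of "l \<theta> s"]]
        by simp
    qed
    show "(\<lambda>s. (l (\<theta> + 1 * h n) s - l \<theta> s) / h n / l \<theta> s) \<in> borel_measurable M" for n
      using density_measurable[OF \<theta>] density_measurable[OF h(3)[of n]] by measurable
  qed
qed

text \<open>The centre of the ball is one of the points over which the supremum is taken, so the
  squared local bound dominates the squared score.\<close>

lemma score_L2:
  assumes \<theta>: "\<theta> \<in> \<Theta>"
  shows "score l \<theta> \<in> L2_space (P \<theta>)"
proof -
  obtain \<epsilon> where \<epsilon>: "\<epsilon> > 0" "cball \<theta> \<epsilon> \<subseteq> \<Theta>"
    and m: "(\<lambda>s. SUP \<delta>\<in>cball \<theta> \<epsilon>. \<bar>score l \<delta> s\<bar>) \<in> L2_space (P \<theta>)"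
    using local_score_bound_L2[OF \<theta>] by blast
  have meas: "score l \<theta> \<in> borel_measurable (P \<theta>)"
    using score_measurable[OF \<theta>] by (simp add: borel_measurable_P[OF \<theta>])
  moreover have "integrable (P \<theta>) (\<lambda>s. (score l \<theta> s)\<^sup>2)"
  proof (rule Bochner_Integration.integrable_bound)
    show "integrable (P \<theta>) (\<lambda>s. (SUP \<delta>\<in>cball \<theta> \<epsilon>. \<bar>score l \<delta> s\<bar>)\<^sup>2)"
      using m by (simp add: L2_space_def)
    show "(\<lambda>s. (score l \<theta> s)\<^sup>2) \<in> borel_measurable (P \<theta>)" using meas by measurable
    show "AE s in P \<theta>. norm ((score l \<theta> s)\<^sup>2) \<le> norm ((SUP \<delta>\<in>cball \<theta> \<epsilon>. \<bar>score l \<delta> s\<bar>)\<^sup>2)"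
    proof (rule AE_I2)
      fix s assume "s \<in> space (P \<theta>)"
      then have "\<bar>score l \<theta> s\<bar> \<le> (SUP \<delta>\<in>cball \<theta> \<epsilon>. \<bar>score l \<delta> s\<bar>)"
        using \<epsilon> by (intro score_le_local_SUP) (auto simp: space_P[OF \<theta>])
      then have "\<bar>score l \<theta> s\<bar>\<^sup>2 \<le> (SUP \<delta>\<in>cball \<theta> \<epsilon>. \<bar>score l \<delta> s\<bar>)\<^sup>2"
        by (intro power_mono) auto
      then show "norm ((score l \<theta> s)\<^sup>2) \<le> norm ((SUP \<delta>\<in>cball \<theta> \<epsilon>. \<bar>score l \<delta> s\<bar>)\<^sup>2)" by simp
    qed
  qed
  ultimately show ?thesis by (simp add: L2_space_def)
qed

lemma L2_imp_integrable:
  assumes "\<theta> \<in> \<Theta>" "f \<in> L2_space (P \<theta>)"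
  shows "integrable (P \<theta>) f"
proof -
  interpret prob_space "P \<theta>" using assms(1) by (rule prob)
  show ?thesis using assms(2) by (auto simp: L2_space_def intro: square_integrable_imp_integrable)
qed

section \<open>The score has mean zero\<close>

lemma integral_likelihood_ratio:
  assumes \<theta>: "\<theta> \<in> \<Theta>" and \<delta>: "\<delta> \<in> \<Theta>"
  shows "integrable (P \<theta>) (\<lambda>s. l \<delta> s / l \<theta> s)" "(\<integral>s. l \<delta> s / l \<theta> s \<partial>P \<theta>) = 1"
proof -
  interpret prob_space "P \<delta>" using \<delta> by (rule prob)
  have meas: "(\<lambda>s. l \<delta> s / l \<theta> s) \<in> borel_measurable M"
    using density_measurable[OF \<theta>] density_measurable[OF \<delta>] by measurable
  \<comment> \<open>The factor \<open>1\<close> presents the integral over \<open>M\<close> as the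
    expectation of the constant \<open>1\<close> under \<open>P \<delta>\<close>, that is, as its
    total mass.\<close>
  have eq: "l \<theta> s * (l \<delta> s / l \<theta> s) = l \<delta> s * 1" if "s \<in> space M" for s
    using density_pos[OF \<theta> that] by simp
  have "integrable M (\<lambda>s. l \<delta> s * 1)" using integrable_P_iff[OF \<delta>, of "\<lambda>_. 1"] by simp
  then show "integrable (P \<theta>) (\<lambda>s. l \<delta> s / l \<theta> s)"
    unfolding integrable_P_iff[OF \<theta> meas]
    by (subst Bochner_Integration.integrable_cong[OF refl eq])
  have "(\<integral>s. l \<delta> s * 1 \<partial>M) = 1" using integral_P[OF \<delta>, of "\<lambda>_. 1"] by (simp add: prob_space)
  then show "(\<integral>s. l \<delta> s / l \<theta> s \<partial>P \<theta>) = 1"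
    unfolding integral_P[OF \<theta> meas]
    by (subst Bochner_Integration.integral_cong[OF refl eq])
qed

text \<open>The mean value inequality bounds the log-likelihood ratio below, and
  \<open>ln x \<le> x - 1\<close> carries this over to the ratio itself. The corresponding upper
  bound would involve the exponential of the local score bound, hence the one-sided
  estimate.\<close>

lemma likelihood_ratio_quotient_ge:
  assumes \<epsilon>: "cball \<theta> \<epsilon> \<subseteq> \<Theta>" and s: "s \<in> space M" and h: "0 < h" "h \<le> \<epsilon>" and \<sigma>: "\<bar>\<sigma>\<bar> = 1"
  shows "- (SUP \<delta>\<in>cball \<theta> \<epsilon>. \<bar>score l \<delta> s\<bar>) \<le> (l (\<theta> + \<sigma> * h) s / l \<theta> s - 1) / h"
proof -
  let ?m = "SUP \<delta>\<in>cball \<theta> \<epsilon>. \<bar>score l \<delta> s\<bar>" and ?\<delta> = "\<theta> + \<sigma> * h"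
  have in_ball: "\<theta> \<in> cball \<theta> \<epsilon>" "?\<delta> \<in> cball \<theta> \<epsilon>" using h \<sigma> by (auto simp: dist_real_def abs_mult)
  then have pos: "l \<theta> s > 0" "l ?\<delta> s > 0" using \<epsilon> s density_pos by blast+
  \<comment> \<open>On the convex ball, \<open>ln l\<close> has the score as its derivative, and
    \<open>?m\<close> bounds the score there.\<close>
  have "norm (ln (l ?\<delta> s) - ln (l \<theta> s)) \<le> ?m * norm (?\<delta> - \<theta>)"
  proof (rule field_differentiable_bound[OF convex_cball _ _ in_ball(2,1)])
    fix \<delta> assume \<delta>: "\<delta> \<in> cball \<theta> \<epsilon>"
    then have "\<delta> \<in> \<Theta>" using \<epsilon> by auto
    from density_has_derivative[OF this s] density_pos[OF this s]
    show "((\<lambda>\<delta>. ln (l \<delta> s)) has_field_derivative score l \<delta> s) (at \<delta> within cball \<theta> \<epsilon>)"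
      by (auto intro!: derivative_eq_intros has_field_derivative_at_within[where s="cball \<theta> \<epsilon>"])
    show "norm (score l \<delta> s) \<le> ?m" using score_le_local_SUP[OF \<epsilon> s \<delta>] by simp
  qed
  then have "- (?m * h) \<le> ln (l ?\<delta> s / l \<theta> s)"
    using h \<sigma> pos by (simp add: abs_mult ln_div)
  also have "\<dots> \<le> l ?\<delta> s / l \<theta> s - 1" using pos by (intro ln_le_minus_one) simp
  finally show ?thesis using h by (simp add: field_simps)
qed

text \<open>The difference quotients of the likelihood ratio integrate to zero and are bounded below
  by an integrable function, so Fatou bounds the integral of their limit by zero. The two values of
  \<open>\<sigma>\<close> give opposite inequalities for the mean of the score.\<close>

lemma score_mean_le:
  assumes \<theta>: "\<theta> \<in> \<Theta>" and \<sigma>: "\<bar>\<sigma>\<bar> = 1"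
  shows "(\<integral>s. \<sigma> * score l \<theta> s \<partial>P \<theta>) \<le> 0"
proof -
  interpret prob_space "P \<theta>" using \<theta> by (rule prob)
  obtain \<epsilon> where \<epsilon>: "\<epsilon> > 0" "cball \<theta> \<epsilon> \<subseteq> \<Theta>"
    and m: "(\<lambda>s. SUP \<delta>\<in>cball \<theta> \<epsilon>. \<bar>score l \<delta> s\<bar>) \<in> L2_space (P \<theta>)"
    using local_score_bound_L2[OF \<theta>] by blast
  obtain h where h: "\<And>n. h n > 0" "\<And>n. h n \<le> \<epsilon>" "h \<longlonglongrightarrow> 0"
    and in_\<Theta>: "\<And>n \<sigma>. \<bar>\<sigma>\<bar> = 1 \<Longrightarrow> \<theta> + \<sigma> * h n \<in> \<Theta>"
    using obtain_interior_seq[OF \<theta> \<epsilon>(1)] by metis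
  note ratio = integral_likelihood_ratio[OF \<theta> in_\<Theta>[OF \<sigma>]]
  show ?thesis
  proof (rule integral_le_of_AE_lim_bounded_below)
    let ?u = "\<lambda>n s. (l (\<theta> + \<sigma> * h n) s / l \<theta> s - 1) / h n"
    show "integrable (P \<theta>) (?u n)" for n using ratio(1)[of n] by simp
    show "integrable (P \<theta>) (\<lambda>s. \<sigma> * score l \<theta> s)"
      using L2_imp_integrable[OF \<theta> score_L2[OF \<theta>]] by simp
    show "integrable (P \<theta>) (\<lambda>s. - (SUP \<delta>\<in>cball \<theta> \<epsilon>. \<bar>score l \<delta> s\<bar>))"
      using L2_imp_integrable[OF \<theta> m] by simp
    show "AE s in P \<theta>. - (SUP \<delta>\<in>cball \<theta> \<epsilon>. \<bar>score l \<delta> s\<bar>) \<le> ?u n s" for n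
      using likelihood_ratio_quotient_ge[OF \<epsilon>(2) _ h(1,2) \<sigma>] by (auto intro!: AE_I2 simp: space_P[OF \<theta>])
    show "AE s in P \<theta>. (\<lambda>n. ?u n s) \<longlonglongrightarrow> \<sigma> * score l \<theta> s"
    proof (rule AE_I2)
      fix s assume "s \<in> space (P \<theta>)"
      then have s: "s \<in> space M" by (simp add: space_P[OF \<theta>])
      note pos = density_pos[OF \<theta> s]
      have "(\<lambda>n. (l (\<theta> + \<sigma> * h n) s - l \<theta> s) / h n / l \<theta> s) \<longlonglongrightarrow> \<sigma> * (score l \<theta> s * l \<theta> s) / l \<theta> s"
        using pos by (intro tendsto_divide tendsto_const
            DERIV_imp_quotient_LIMSEQ[OF density_has_derivative[OF \<theta> s] h(3,1) \<sigma>]) auto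
      moreover have "(l (\<theta> + \<sigma> * h n) s - l \<theta> s) / h n / l \<theta> s = ?u n s" for n
        using pos h(1)[of n] by (simp add: field_simps)
      ultimately show "(\<lambda>n. ?u n s) \<longlonglongrightarrow> \<sigma> * score l \<theta> s" using pos by simp
    qed
    \<comment> \<open>The likelihood ratio and the constant \<open>1\<close> both have integral one
      under \<open>P \<theta>\<close>.\<close>
    show "(\<integral>s. ?u n s \<partial>P \<theta>) \<le> 0" for n using ratio[of n] by (simp add: prob_space)
  qed
qed

lemma score_mean_zero:
  assumes "\<theta> \<in> \<Theta>"
  shows "(\<integral>s. score l \<theta> s \<partial>P \<theta>) = 0"
  using score_mean_le[OF assms, of 1] score_mean_le[OF assms, of "-1"] by simp

section \<open>Differentiation under the integral sign and the information bound\<close>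

lemma fisher_information_eq:
  assumes "\<theta> \<in> \<Theta>"
  shows "fisher_information P l \<theta> = (\<integral>s. (score l \<theta> s)\<^sup>2 \<partial>P \<theta>)"
  using score_L2[OF assms] by (auto simp: fisher_information_def L2_space_def intro!: expect_eq_integral)

text \<open>The integral of \<open>\<tau> l\<close> over \<open>M\<close> is zero at every parameter
  in \<open>\<Theta>\<close>, hence so are the integrals of its difference quotients.
  \<open>dominated_at\<close> lets dominated convergence pass this to the derivative, and the
  product rule splits off \<open>\<tau>\<close> times the score, which is integrable under
  \<open>P \<theta>\<close> as a product of two square-integrable functions.\<close>

lemma expect_deriv_eq:
  assumes est: "generalized_estimator \<Theta> P \<tau>" and \<theta>: "\<theta> \<in> \<Theta>" and dom: "dominated_at \<Theta> M l \<tau> \<theta>"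
  shows "expect (P \<theta>) (\<lambda>s. deriv (\<tau> s) \<theta>) = - (\<integral>s. \<tau> s \<theta> * score l \<theta> s \<partial>P \<theta>)"
proof -
  have \<tau>_L2: "(\<lambda>s. \<tau> s \<delta>) \<in> L2_space (P \<delta>)" if "\<delta> \<in> \<Theta>" for \<delta>
    using est that by (auto simp: generalized_estimator_def)
  have \<tau>_meas: "(\<lambda>s. \<tau> s \<delta>) \<in> borel_measurable M" if "\<delta> \<in> \<Theta>" for \<delta>
    using \<tau>_L2[OF that] by (simp add: L2_space_def borel_measurable_P[OF that])
  have \<tau>_zero: "(\<integral>s. \<tau> s \<delta> \<partial>P \<delta>) = 0" if "\<delta> \<in> \<Theta>" for \<delta>
    using est that expect_eq_integral[of "\<lambda>s. \<tau> s \<delta>" "P \<delta>"] \<tau>_meas[OF that]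
    by (simp add: generalized_estimator_def borel_measurable_P[OF that])
  have \<tau>l_int: "integrable M (\<lambda>s. \<tau> s \<delta> * l \<delta> s)" and \<tau>l_zero: "(\<integral>s. \<tau> s \<delta> * l \<delta> s \<partial>M) = 0"
    if "\<delta> \<in> \<Theta>" for \<delta>
    using L2_imp_integrable[OF that \<tau>_L2[OF that]] \<tau>_zero[OF that]
    by (simp_all add: integrable_P_iff integral_P \<tau>_meas that mult.commute)
  obtain \<epsilon> G where \<epsilon>: "\<epsilon> > 0" and G: "integrable M G" and le_G:
    "AE s in M. \<forall>\<delta>\<in>\<Theta> \<inter> cball \<theta> \<epsilon>. \<bar>\<tau> s \<delta> * l \<delta> s - \<tau> s \<theta> * l \<theta> s\<bar> \<le> G s * \<bar>\<delta> - \<theta>\<bar>"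
    using dom unfolding dominated_at_def by blast
  obtain h where h: "\<And>n. h n > 0" "\<And>n. h n \<le> \<epsilon>" "h \<longlonglongrightarrow> 0"
    and in_\<Theta>: "\<And>n \<sigma>. \<bar>\<sigma>\<bar> = 1 \<Longrightarrow> \<theta> + \<sigma> * h n \<in> \<Theta>"
    using obtain_interior_seq[OF \<theta> \<epsilon>] by metis
  have in_\<Theta>1: "\<theta> + 1 * h n \<in> \<Theta>" for n by (rule in_\<Theta>) simp
  \<comment> \<open>The factor \<open>1\<close> is the sign \<open>\<sigma>\<close> of
    \<open>DERIV_imp_quotient_LIMSEQ\<close>. The right-hand side of \<open>\<theta>\<close> is
    enough here, because dominated convergence yields an equality.\<close>
  define u where "u = (\<lambda>n s. (\<tau> s (\<theta> + 1 * h n) * l (\<theta> + 1 * h n) s - \<tau> s \<theta> * l \<theta> s) / h n)"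
  have u_int: "integrable M (u n)" and u_zero: "(\<integral>s. u n s \<partial>M) = 0" for n
    unfolding u_def using \<tau>l_int[OF \<theta>] \<tau>l_int[OF in_\<Theta>1] \<tau>l_zero[OF \<theta>] \<tau>l_zero[OF in_\<Theta>1] by simp_all
  \<comment> \<open>The function \<open>\<lambda>s. deriv (\<tau> s) \<theta>\<close> need not be
    measurable, since \<open>\<tau> s\<close> may fail to be differentiable on a null set. The total
    operator \<open>lim\<close> gives a measurable function that equals the derivative of the
    product almost everywhere.\<close>
  define D where "D = (\<lambda>s. lim (\<lambda>n. u n s))"
  have D_meas: "D \<in> borel_measurable M"
    unfolding D_def using u_int by (intro borel_measurable_lim_metric) auto
  have diff: "AE s in M. \<tau> s C1_differentiable_on \<Theta>"
    using est \<theta> by (auto simp: generalized_estimator_def AE_P_iff[OF \<theta>])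
  have lim: "AE s in M. (\<lambda>n. u n s) \<longlonglongrightarrow> deriv (\<tau> s) \<theta> * l \<theta> s + \<tau> s \<theta> * (score l \<theta> s * l \<theta> s)"
    using diff AE_space
  proof eventually_elim
    case (elim s)
    then obtain d where d: "(\<tau> s has_real_derivative d) (at \<theta>)"
      using \<theta> by (auto simp: C1_differentiable_on_def has_real_derivative_iff_has_vector_derivative)
    show ?case
      using DERIV_imp_quotient_LIMSEQ[OF DERIV_mult'[OF d density_has_derivative[OF \<theta> elim(2)]] h(3,1), of 1]
      by (simp add: u_def DERIV_imp_deriv[OF d] add.commute)
  qed
  then have D_eq: "AE s in M. D s = deriv (\<tau> s) \<theta> * l \<theta> s + \<tau> s \<theta> * (score l \<theta> s * l \<theta> s)"
    by eventually_elim (auto simp: D_def intro: limI)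
  have u_D: "AE s in M. (\<lambda>n. u n s) \<longlonglongrightarrow> D s"
    using lim D_eq by eventually_elim simp
  have u_le: "AE s in M. norm (u n s) \<le> G s" for n
    using le_G
  proof eventually_elim
    case (elim s)
    moreover have "\<theta> + 1 * h n \<in> cball \<theta> \<epsilon>" using h(1,2)[of n] by (simp add: dist_real_def)
    ultimately have "\<bar>\<tau> s (\<theta> + 1 * h n) * l (\<theta> + 1 * h n) s - \<tau> s \<theta> * l \<theta> s\<bar> \<le> G s * h n"
      using in_\<Theta>1[of n] h(1)[of n] by force
    then show ?case using h(1)[of n] by (simp add: u_def field_simps)
  qed
  have D_int: "integrable M D"
    using D_meas borel_measurable_integrable[OF u_int] G u_D u_le
    by (rule integrable_dominated_convergence)
  have "(\<lambda>n. \<integral>s. u n s \<partial>M) \<longlonglongrightarrow> (\<integral>s. D s \<partial>M)"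
    using D_meas borel_measurable_integrable[OF u_int] G u_D u_le
    by (rule integral_dominated_convergence)
  then have D_zero: "(\<integral>s. D s \<partial>M) = 0" by (simp add: u_zero LIMSEQ_const_iff)
  have \<tau>\<gamma>_meas: "(\<lambda>s. \<tau> s \<theta> * score l \<theta> s) \<in> borel_measurable M"
    using \<tau>_meas[OF \<theta>] score_measurable[OF \<theta>] by measurable
  have \<tau>\<gamma>_int: "integrable M (\<lambda>s. l \<theta> s * (\<tau> s \<theta> * score l \<theta> s))"
    using L2_space_integrable_mult[OF \<tau>_L2[OF \<theta>] score_L2[OF \<theta>]]
    by (simp add: integrable_P_iff[OF \<theta> \<tau>\<gamma>_meas])
  \<comment> \<open>Solving the product rule for the derivative of \<open>\<tau> s\<close> gives a
    measurable version of it.\<close>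
  define T where "T = (\<lambda>s. D s / l \<theta> s - \<tau> s \<theta> * score l \<theta> s)"
  have T_meas: "T \<in> borel_measurable M"
    unfolding T_def using D_meas \<tau>\<gamma>_meas density_measurable[OF \<theta>] by measurable
  have "AE s in M. deriv (\<tau> s) \<theta> = T s"
    using D_eq AE_space
    by eventually_elim (use density_pos[OF \<theta>] in \<open>force simp: T_def field_simps\<close>)
  \<comment> \<open>Over the completion, almost everywhere equality alone makes the two integrals
    agree, without measurability of the left-hand function with respect to
    \<open>P \<theta>\<close>.\<close>
  then have "AE s in completion (P \<theta>). deriv (\<tau> s) \<theta> = T s"
    by (intro AE_completion) (simp add: AE_P_iff[OF \<theta>])
  then have "expect (P \<theta>) (\<lambda>s. deriv (\<tau> s) \<theta>) = expect (P \<theta>) T"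
    unfolding expect_def by (rule integral_completion_cong_AE)
  also have "\<dots> = (\<integral>s. l \<theta> s * T s \<partial>M)"
    using T_meas by (simp add: expect_eq_integral borel_measurable_P[OF \<theta>] integral_P[OF \<theta>])
  also have "\<dots> = (\<integral>s. D s - l \<theta> s * (\<tau> s \<theta> * score l \<theta> s) \<partial>M)"
  proof (rule Bochner_Integration.integral_cong[OF refl])
    fix s assume "s \<in> space M"
    from density_pos[OF \<theta> this]
    show "l \<theta> s * T s = D s - l \<theta> s * (\<tau> s \<theta> * score l \<theta> s)" by (simp add: T_def field_simps)
  qed
  also have "\<dots> = - (\<integral>s. \<tau> s \<theta> * score l \<theta> s \<partial>P \<theta>)"
    using D_int D_zero \<tau>\<gamma>_int by (simp add: integral_P[OF \<theta> \<tau>\<gamma>_meas])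
  finally show ?thesis .
qed

text \<open>As \<open>\<tau>\<close> and the score both have mean zero, variances are second moments
  and the covariance is the integral of the product. The minus sign of
  \<open>expect_deriv_eq\<close> disappears in the square, which leaves the quotient treated by
  \<open>L2_Cauchy_Schwarz\<close>.\<close>

lemma information_properties:
  assumes est: "generalized_estimator \<Theta> P \<tau>" and \<theta>: "\<theta> \<in> \<Theta>" and dom: "dominated_at \<Theta> M l \<tau> \<theta>"
  shows "information P \<tau> \<theta> = (corr (P \<theta>) (\<lambda>s. \<tau> s \<theta>) (score l \<theta>))\<^sup>2 * fisher_information P l \<theta>"
    and "information P \<tau> \<theta> \<le> fisher_information P l \<theta>"
    and "information P \<tau> \<theta> = fisher_information P l \<theta> \<longleftrightarrow>
      (\<exists>c. AE s in P \<theta>. \<tau> s \<theta> = c * score l \<theta> s)"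
proof -
  have \<tau>: "(\<lambda>s. \<tau> s \<theta>) \<in> L2_space (P \<theta>)" and \<tau>_zero: "expect (P \<theta>) (\<lambda>s. \<tau> s \<theta>) = 0"
    and \<tau>_pos: "estimator_var P \<tau> \<theta> > 0"
    using est \<theta> unfolding generalized_estimator_def by blast+
  note \<gamma> = score_L2[OF \<theta>]
  have meas: "(\<lambda>s. \<tau> s \<theta>) \<in> borel_measurable (P \<theta>)" "score l \<theta> \<in> borel_measurable (P \<theta>)"
    using \<tau> \<gamma> by (auto simp: L2_space_def)
  have V: "estimator_var P \<tau> \<theta> = (\<integral>s. (\<tau> s \<theta>)\<^sup>2 \<partial>P \<theta>)"
    unfolding estimator_var_def using meas by (intro expect_eq_integral) simp
  note I = fisher_information_eq[OF \<theta>]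
  have I_pos: "fisher_information P l \<theta> > 0" using \<theta> by (rule fisher_information_pos)
  have \<gamma>_zero: "expect (P \<theta>) (score l \<theta>) = 0"
    using meas score_mean_zero[OF \<theta>] by (simp add: expect_eq_integral)
  have \<tau>\<gamma>: "expect (P \<theta>) (\<lambda>s. \<tau> s \<theta> * score l \<theta> s) = (\<integral>s. \<tau> s \<theta> * score l \<theta> s \<partial>P \<theta>)"
    using meas by (intro expect_eq_integral) simp
  have info: "information P \<tau> \<theta> = (\<integral>s. \<tau> s \<theta> * score l \<theta> s \<partial>P \<theta>)\<^sup>2 / (\<integral>s. (\<tau> s \<theta>)\<^sup>2 \<partial>P \<theta>)"
    unfolding information_def expect_deriv_eq[OF est \<theta> dom] V by simp
  have "var (P \<theta>) (\<lambda>s. \<tau> s \<theta>) = estimator_var P \<tau> \<theta>"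
    by (simp add: var_def \<tau>_zero estimator_var_def)
  moreover have "var (P \<theta>) (score l \<theta>) = fisher_information P l \<theta>"
    by (simp add: var_def \<gamma>_zero fisher_information_def)
  ultimately have "corr (P \<theta>) (\<lambda>s. \<tau> s \<theta>) (score l \<theta>) = (\<integral>s. \<tau> s \<theta> * score l \<theta> s \<partial>P \<theta>) /
      (sqrt (estimator_var P \<tau> \<theta>) * sqrt (fisher_information P l \<theta>))"
    by (simp add: corr_def \<tau>_zero \<gamma>_zero \<tau>\<gamma>)
  then show "information P \<tau> \<theta> =
      (corr (P \<theta>) (\<lambda>s. \<tau> s \<theta>) (score l \<theta>))\<^sup>2 * fisher_information P l \<theta>"
    using \<tau>_pos I_pos by (simp add: info V[symmetric] power_divide power_mult_distrib)
  show "information P \<tau> \<theta> \<le> fisher_information P l \<theta>"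
    unfolding info I using L2_Cauchy_Schwarz(1)[OF \<tau> \<gamma>] \<tau>_pos I_pos by (simp add: V I)
  show "information P \<tau> \<theta> = fisher_information P l \<theta> \<longleftrightarrow>
      (\<exists>c. AE s in P \<theta>. \<tau> s \<theta> = c * score l \<theta> s)"
    unfolding info I using L2_Cauchy_Schwarz(2)[OF \<tau> \<gamma>] \<tau>_pos I_pos by (simp add: V I)
qed

text \<open>The score inherits continuous differentiability from \<open>l'\<close> and
  \<open>l\<close> by the quotient rule; \<open>density_C1\<close> by itself makes the score only
  continuous. Its mean and variance clauses come from \<open>score_mean_zero\<close> and the
  positive Fisher information.\<close>

lemma score_generalized_estimator:
  assumes "AE s in M. (\<lambda>\<theta>. deriv (\<lambda>\<delta>. l \<delta> s) \<theta>) C1_differentiable_on \<Theta>"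
  shows "generalized_estimator \<Theta> P (\<lambda>s \<theta>. score l \<theta> s)"
  unfolding generalized_estimator_def
proof (intro conjI ballI)
  fix \<theta> assume \<theta>: "\<theta> \<in> \<Theta>"
  have "score l \<theta> \<in> L2_space (P \<theta>)" by (rule score_L2[OF \<theta>])
  then show "(\<lambda>s. score l \<theta> s) \<in> L2_space (P \<theta>)" .
  then show "expect (P \<theta>) (\<lambda>s. score l \<theta> s) = 0"
    using score_mean_zero[OF \<theta>] by (simp add: L2_space_def expect_eq_integral)
  show "estimator_var P (\<lambda>s \<theta>. score l \<theta> s) \<theta> > 0"
    using fisher_information_pos[OF \<theta>] by (simp add: estimator_var_def fisher_information_def)
  show "AE s in P \<theta>. (\<lambda>\<theta>. score l \<theta> s) C1_differentiable_on \<Theta>"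
    unfolding AE_P_iff[OF \<theta>] using assms AE_space
  proof eventually_elim
    case (elim s)
    show ?case unfolding score_def
    proof (rule C1_differentiable_on_divide_real[OF elim(1) density_C1[OF elim(2)]])
      show "l x s \<noteq> 0" if "x \<in> \<Theta>" for x using density_pos[OF that elim(2)] by simp
    qed
  qed
qed

end

theorem theorem1:
  fixes \<Theta> :: "real set" and M :: "'s measure"
    and P :: "real \<Rightarrow> 's measure" and l :: "real \<Rightarrow> 's \<Rightarrow> real"
  assumes "regular_family \<Theta> M P l"
  shows "(\<forall>\<tau>. generalized_estimator \<Theta> P \<tau> \<longrightarrow>
            (\<forall>\<theta>\<in>\<Theta>. dominated_at \<Theta> M l \<tau> \<theta> \<longrightarrow>
               information P \<tau> \<theta> =
                 (corr (P \<theta>) (\<lambda>s. \<tau> s \<theta>) (score l \<theta>))\<^sup>2 * fisher_information P l \<theta> \<and>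
               information P \<tau> \<theta> \<le> fisher_information P l \<theta> \<and>
               (information P \<tau> \<theta> = fisher_information P l \<theta> \<longleftrightarrow>
                  (\<exists>c. AE s in P \<theta>. \<tau> s \<theta> = c * score l \<theta> s))))
       \<and> ((AE s in M. (\<lambda>\<theta>. deriv (\<lambda>\<delta>. l \<delta> s) \<theta>) C1_differentiable_on \<Theta>) \<longrightarrow>
            generalized_estimator \<Theta> P (\<lambda>s \<theta>. score l \<theta> s) \<and>
            (\<forall>\<theta>\<in>\<Theta>. dominated_at \<Theta> M l (\<lambda>s \<theta>. score l \<theta> s) \<theta> \<longrightarrow>
               information P (\<lambda>s \<theta>. score l \<theta> s) \<theta> = fisher_information P l \<theta>))"
proof -
  interpret regular_family \<Theta> M P l by (rule assms)
  \<comment> \<open>This is the equality case of the bound: the score is \<open>1\<close> times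
    itself.\<close>
  have "information P (\<lambda>s \<theta>. score l \<theta> s) \<theta> = fisher_information P l \<theta>"
    if "generalized_estimator \<Theta> P (\<lambda>s \<theta>. score l \<theta> s)" "\<theta> \<in> \<Theta>"
      "dominated_at \<Theta> M l (\<lambda>s \<theta>. score l \<theta> s) \<theta>" for \<theta>
    unfolding information_properties(3)[OF that] by (rule exI[of _ 1]) simp
  then show ?thesis
    using information_properties score_generalized_estimator by blast
qed

end
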